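(* Let $X$ be a sequentially complete locally convex space, $T$ a continuous linear operator on $X$, and $\lambda\in\mathbb{C}$. If $|\lambda|>r_c(T)$, then $\lambda I-T$ is invertible, the Neumann series $\sum_{i=0}^\infty \frac{T^i}{\lambda^{i+1}}$ converges equicontinuously to $R_\lambda=(\lambda I-T)^{-1}$, and $R_\lambda$ is continuous. In particular, $|\sigma^c(T)|\le r_c(T)$.
   Context: Spaces are over $\mathbb{C}$; locally convex spaces are Hausdorff by definition. A sequence $(S_n)$ of operators converges to zero equicontinuously if for each zero neighborhood $V$ there is a zero neighborhood $U$ such that for every $\varepsilon>0$ there exists $n_0$ with $S_n(U)\subseteq\varepsilon V$ for all $n>n_0$; $(S_n)$ converges equicontinuously to $S$ if $(S_n-S)$ converges to zero equicontinuously; convergence of a series means convergence of its partial sums. $\rho^{c}(T)$ is the set of $\lambda\in\mathbb{C}$ for which $\lambda I-T$ has a (two-sided) inverse which is continuous; $\sigma^{c}(T)=\mathbb{C}\setminus\rho^{c}(T)$; $R_\lambda$ denotes the inverse of $\lambda I-T$. For $\sigma\subseteq\mathbb{C}$, $|\sigma|=\sup\{|\lambda| : \lambda\in\sigma\}$, with $\sup\emptyset=0$. The spectral radius is $$r_{c}(T)=\inf\Bigl\{\nu>0 : \tfrac{T^n}{\nu^n}\to 0 \text{ equicontinuously}\Bigr\},$$ with $\inf\emptyset=\infty$. *)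

theory Defs
  imports "HOL-Analysis.Analysis"
begin

text \<open>
  A complex vector space carries its underlying real vector space structure, so that the
  notions for class \<open>real_vector\<close> (such as \<open>convex\<close>) apply to it. The last axiom determines
  \<open>scaleR\<close> from \<open>scaleC\<close>, so this is no restriction.
\<close>

class complex_vector = real_vector +
  fixes scaleC :: "complex \<Rightarrow> 'a \<Rightarrow> 'a"  (infixr \<open>*\<^sub>C\<close> 75)
  assumes scaleC_add_right: "a *\<^sub>C (x + y) = a *\<^sub>C x + a *\<^sub>C y"
    and scaleC_add_left: "(a + b) *\<^sub>C x = a *\<^sub>C x + b *\<^sub>C x"
    and scaleC_scaleC: "a *\<^sub>C b *\<^sub>C x = (a * b) *\<^sub>C x"
    and scaleC_one: "1 *\<^sub>C x = x"
    and scaleR_scaleC: "scaleR r x = complex_of_real r *\<^sub>C x"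

lemma vector_space_scaleC: "vector_space (scaleC :: complex \<Rightarrow> 'a::complex_vector \<Rightarrow> 'a)"
  by unfold_locales
    (simp_all add: scaleC_add_right scaleC_add_left scaleC_scaleC scaleC_one)

text \<open>
  The first axiom is joint continuity of scalar multiplication, in the style of
  \<open>topological_monoid_add\<close>. The second says that zero has a base of convex neighborhoods,
  with \<open>convex\<close> written out because that constant is not available inside a class
  specification.
\<close>

class locally_convex_space = complex_vector + topological_ab_group_add + t2_space +
  assumes tendsto_scaleC_Pair:
      "LIM p (nhds a \<times>\<^sub>F nhds x). fst p *\<^sub>C snd p :> nhds (a *\<^sub>C x)"
    and ex_convex_nhd_0:
      "open U \<Longrightarrow> 0 \<in> U \<Longrightarrow> \<exists>V. open V \<and> 0 \<in> V \<and> V \<subseteq> U \<and>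
        (\<forall>x\<in>V. \<forall>y\<in>V. \<forall>u\<ge>0. \<forall>v\<ge>0. u + v = 1 \<longrightarrow> scaleR u x + scaleR v y \<in> V)"

lemma ex_open_convex_nhd_0:
  fixes U :: "'a::locally_convex_space set"
  assumes "open U" "0 \<in> U"
  obtains V where "open V" "0 \<in> V" "V \<subseteq> U" "convex V"
  using ex_convex_nhd_0[OF assms] unfolding convex_def by auto

text \<open>
  The library's \<open>Cauchy\<close> refers to a uniformity; here it is the one induced by the additive
  topological group.
\<close>

class sequentially_complete_locally_convex_space = locally_convex_space +
  assumes sequentially_complete:
    "(\<And>U. open U \<Longrightarrow> 0 \<in> U \<Longrightarrow> \<exists>N. \<forall>m\<ge>N. \<forall>n\<ge>N. X m - X n \<in> U) \<Longrightarrow> convergent X"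

definition zero_nhd :: "'a::{topological_space,zero} set \<Rightarrow> bool" where
  "zero_nhd U \<longleftrightarrow> 0 \<in> interior U"

definition equicont_to_zero :: "(nat \<Rightarrow> 'a::locally_convex_space \<Rightarrow> 'a) \<Rightarrow> bool" where
  "equicont_to_zero S \<longleftrightarrow>
     (\<forall>V. zero_nhd V \<longrightarrow> (\<exists>U. zero_nhd U \<and>
       (\<forall>\<epsilon>>0. \<exists>n0. \<forall>n>n0. S n ` U \<subseteq> (\<lambda>x. \<epsilon> *\<^sub>R x) ` V)))"

definition equicont_converges ::
    "(nat \<Rightarrow> 'a \<Rightarrow> 'a) \<Rightarrow> ('a::locally_convex_space \<Rightarrow> 'a) \<Rightarrow> bool" where
  "equicont_converges S L \<longleftrightarrow> equicont_to_zero (\<lambda>n x. S n x - L x)"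

definition equicont_sums ::
    "(nat \<Rightarrow> 'a \<Rightarrow> 'a) \<Rightarrow> ('a::locally_convex_space \<Rightarrow> 'a) \<Rightarrow> bool" where
  "equicont_sums A L \<longleftrightarrow> equicont_converges (\<lambda>n x. \<Sum>i<n. A i x) L"

definition resolvent :: "('a::locally_convex_space \<Rightarrow> 'a) \<Rightarrow> complex \<Rightarrow> 'a \<Rightarrow> 'a" where
  "resolvent T \<mu> = inv (\<lambda>x. \<mu> *\<^sub>C x - T x)"

text \<open>The inverse of a bijective linear operator is linear, so this need not be required.\<close>

definition resolvent_set :: "('a::locally_convex_space \<Rightarrow> 'a) \<Rightarrow> complex set" where
  "resolvent_set T =
     {\<mu>. bij (\<lambda>x. \<mu> *\<^sub>C x - T x) \<and> continuous_on UNIV (resolvent T \<mu>)}"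

definition spectrum :: "('a::locally_convex_space \<Rightarrow> 'a) \<Rightarrow> complex set" where
  "spectrum T = - resolvent_set T"

text \<open>
  In \<open>ennreal\<close>, the supremum of the empty set is \<open>0\<close> and its infimum is \<open>\<infinity>\<close>, which are the
  conventions wanted in the next two definitions.
\<close>

definition set_radius :: "complex set \<Rightarrow> ennreal" where
  "set_radius \<sigma> = (SUP \<mu>\<in>\<sigma>. ennreal (cmod \<mu>))"

definition spectral_radius :: "('a::locally_convex_space \<Rightarrow> 'a) \<Rightarrow> ennreal" where
  "spectral_radius T =
     Inf {ennreal \<nu> |\<nu>. \<nu> > 0 \<and> equicont_to_zero (\<lambda>n x. (T ^^ n) x /\<^sub>R \<nu> ^ n)}"

end

theory Submission
  imports Defs
begin

text \<open>
  If \<open>r\<^sub>c(T) < \<nu> < |\<mu>|\<close> with \<open>T\<^sup>n / \<nu>\<^sup>n \<rightarrow> 0\<close> equicontinuously, then for every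
  absolutely convex zero neighborhood \<open>W\<close> there are a zero neighborhood \<open>U\<close> and an index
  beyond which \<open>T\<^sup>n / \<nu>\<^sup>n\<close> maps \<open>U\<close> into \<open>W\<close>. On \<open>U\<close>, the segments of the Neumann series
  then lie in the multiple of \<open>W\<close> given by the corresponding segment of the geometric series
  with ratio \<open>\<nu> / |\<mu>|\<close>. So the partial sums are Cauchy uniformly on \<open>U\<close>, and since \<open>U\<close> is
  absorbing they converge everywhere. The limit is continuous because its difference to some
  continuous partial sum maps \<open>U\<close> into \<open>W\<close>, and it inverts \<open>\<mu> I - T\<close> by telescoping.
\<close>

section \<open>Scalar multiplication, zero neighborhoods and absolutely convex sets\<close>

interpretation scaleC: vector_space "scaleC :: complex \<Rightarrow> 'a::complex_vector \<Rightarrow> 'a"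
  by (rule vector_space_scaleC)

lemma scaleC_scaleR_commute: "c *\<^sub>C (r *\<^sub>R x) = r *\<^sub>R (c *\<^sub>C x)" for x :: "'a::complex_vector"
  by (simp add: scaleR_scaleC scaleC_scaleC mult.commute)

lemma tendsto_scaleC:
  fixes g :: "'b \<Rightarrow> 'a::locally_convex_space"
  assumes "(f \<longlongrightarrow> a) F" "(g \<longlongrightarrow> x) F"
  shows "((\<lambda>z. f z *\<^sub>C g z) \<longlongrightarrow> a *\<^sub>C x) F"
  using filterlim_compose[OF tendsto_scaleC_Pair filterlim_Pair[OF assms]] by simp

lemma tendsto_scaleR_lcs:
  fixes g :: "'b \<Rightarrow> 'a::locally_convex_space"
  assumes "(f \<longlongrightarrow> a) F" "(g \<longlongrightarrow> x) F"
  shows "((\<lambda>z. f z *\<^sub>R g z) \<longlongrightarrow> a *\<^sub>R x) F"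
  unfolding scaleR_scaleC by (intro tendsto_scaleC tendsto_of_real assms)

lemma zero_nhd_iff_eventually: "zero_nhd W \<longleftrightarrow> (\<forall>\<^sub>F x in nhds 0. x \<in> W)"
  by (auto simp: zero_nhd_def interior_def eventually_nhds)

lemma zero_nhd_tendsto:
  assumes "zero_nhd W" "(f \<longlongrightarrow> 0) F"
  shows "\<forall>\<^sub>F z in F. f z \<in> W"
  using assms unfolding zero_nhd_iff_eventually filterlim_iff by blast

text \<open>Balancedness is taken over complex scalars because the coefficients of the Neumann
  series are complex.\<close>

definition absconvex :: "'a::complex_vector set \<Rightarrow> bool" where
  "absconvex W \<longleftrightarrow> convex W \<and> (\<forall>c. \<forall>x\<in>W. cmod c \<le> 1 \<longrightarrow> c *\<^sub>C x \<in> W)"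

lemma absconvex_scaleC: "absconvex W \<Longrightarrow> x \<in> W \<Longrightarrow> cmod c \<le> 1 \<Longrightarrow> c *\<^sub>C x \<in> W"
  by (simp add: absconvex_def)

lemma absconvex_scaleR:
  assumes "absconvex W" "x \<in> W" "\<bar>r\<bar> \<le> 1"
  shows "r *\<^sub>R x \<in> W"
  unfolding scaleR_scaleC using assms by (intro absconvex_scaleC) auto

text \<open>Membership in \<open>r W\<close> replaces a seminorm bound by r, so no Minkowski
  functional is introduced. This is monotonicity in r; \<open>convex_image_add\<close> is the
  triangle inequality.\<close>

lemma absconvex_image_mono:
  assumes "absconvex W" "\<bar>a\<bar> \<le> b" "b > 0"
  shows "(\<lambda>x. a *\<^sub>R x) ` W \<subseteq> (\<lambda>x. b *\<^sub>R x) ` W"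
proof clarify
  fix w assume "w \<in> W"
  then have "(a / b) *\<^sub>R w \<in> W"
    using assms by (intro absconvex_scaleR) auto
  then show "a *\<^sub>R w \<in> (\<lambda>x. b *\<^sub>R x) ` W"
    using \<open>b > 0\<close> by (intro image_eqI[where x = "(a / b) *\<^sub>R w"]) auto
qed

lemma absconvex_uminus_image:
  assumes "absconvex W" "x \<in> (\<lambda>x. r *\<^sub>R x) ` W"
  shows "- x \<in> (\<lambda>x. r *\<^sub>R x) ` W"
proof -
  obtain w where w: "w \<in> W" "x = r *\<^sub>R w" using assms(2) by auto
  have "- w \<in> W" using absconvex_scaleR[OF assms(1) w(1), of "-1"] by simp
  then show ?thesis using w by (intro image_eqI[where x = "- w"]) auto
qed

lemma convex_image_add:
  fixes W :: "'a::real_vector set"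
  assumes "convex W" "x \<in> (\<lambda>x. a *\<^sub>R x) ` W" "y \<in> (\<lambda>x. b *\<^sub>R x) ` W" "a \<ge> 0" "b \<ge> 0"
  shows "x + y \<in> (\<lambda>x. (a + b) *\<^sub>R x) ` W"
proof -
  obtain v w where vw: "v \<in> W" "x = a *\<^sub>R v" "w \<in> W" "y = b *\<^sub>R w" using assms(2,3) by auto
  show ?thesis
  proof (cases "a + b = 0")
    \<comment> \<open>The convex weights of the other case divide by a + b.\<close>
    case True
    then have "a = 0" "b = 0" using assms by auto
    then show ?thesis using vw by (auto intro!: image_eqI[where x = v])
  next
    case False
    then have pos: "a + b > 0" using assms by auto
    have "(a / (a + b)) *\<^sub>R v + (b / (a + b)) *\<^sub>R w \<in> W"
      using assms vw pos False by (intro convexD) (auto simp flip: add_divide_distrib)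
    then show ?thesis
      using vw False by (intro image_eqI[where x = "(a / (a + b)) *\<^sub>R v + (b / (a + b)) *\<^sub>R w"])
        (auto simp: scaleR_add_right)
  qed
qed

text \<open>Balancedness absorbs the phase \<open>sgn (c i)\<close> into W, which leaves the
  nonnegative weights \<open>cmod (c i)\<close> for convexity. Nonemptiness of W covers the empty
  sum, as 0 = 0 w needs some w in W.\<close>

lemma absconvex_sum:
  assumes "finite I" "absconvex W" "W \<noteq> {}" "\<And>i. i \<in> I \<Longrightarrow> y i \<in> W"
  shows "(\<Sum>i\<in>I. c i *\<^sub>C y i) \<in> (\<lambda>x. (\<Sum>i\<in>I. cmod (c i)) *\<^sub>R x) ` W"
  using assms(1,4)
proof (induction I rule: finite_induct)
  case empty
  then show ?case using \<open>W \<noteq> {}\<close> by auto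
next
  case (insert i I)
  have "sgn (c i) *\<^sub>C y i \<in> W"
    using insert.prems assms(2) by (intro absconvex_scaleC) (auto simp: norm_sgn)
  moreover have "c i *\<^sub>C y i = cmod (c i) *\<^sub>R (sgn (c i) *\<^sub>C y i)"
    by (simp add: scaleR_scaleC scaleC_scaleC sgn_eq)
  ultimately have "c i *\<^sub>C y i \<in> (\<lambda>x. cmod (c i) *\<^sub>R x) ` W"
    by blast
  with insert show ?case
    using assms(2) by (auto simp: absconvex_def intro!: convex_image_add sum_nonneg)
qed

section \<open>Zero neighborhoods of a locally convex space and continuity at 0\<close>

lemma zero_nhd_image:
  fixes W :: "'a::locally_convex_space set"
  assumes "zero_nhd W" "r \<noteq> 0"
  shows "zero_nhd ((\<lambda>x. r *\<^sub>R x) ` W)"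
proof -
  have "((\<lambda>x::'a. inverse r *\<^sub>R x) \<longlongrightarrow> inverse r *\<^sub>R 0) (nhds 0)"
    by (intro tendsto_scaleR_lcs tendsto_const filterlim_ident)
  then have "\<forall>\<^sub>F x in nhds 0. inverse r *\<^sub>R x \<in> W"
    using zero_nhd_tendsto[OF assms(1)] by simp
  then show ?thesis
    unfolding zero_nhd_iff_eventually
  proof eventually_elim
    case (elim x)
    then show ?case using assms(2) by (intro image_eqI[where x = "inverse r *\<^sub>R x"]) auto
  qed
qed

text \<open>By continuity of scalar multiplication t x tends to 0 as t tends to 0; the one-sided
  filter keeps t positive.\<close>

lemma zero_nhd_absorbing:
  fixes U :: "'a::locally_convex_space set"
  assumes "zero_nhd U"
  obtains t where "t > 0" "t *\<^sub>R x \<in> U"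
proof -
  have "((\<lambda>t. t *\<^sub>R x) \<longlongrightarrow> 0 *\<^sub>R x) (at_right 0)"
    by (intro tendsto_scaleR_lcs tendsto_const tendsto_ident_at)
  then have "\<forall>\<^sub>F t in at_right 0. t *\<^sub>R x \<in> U"
    using zero_nhd_tendsto[OF assms] by simp
  then have "\<forall>\<^sub>F t in at_right 0. t > 0 \<and> t *\<^sub>R x \<in> U"
    using eventually_at_right_less by eventually_elim simp
  then have "\<exists>t>0. t *\<^sub>R x \<in> U"
    using eventually_happens[of _ "at_right (0::real)"] by auto
  then show thesis using that by auto
qed

lemma ex_absconvex_zero_nhd:
  fixes V :: "'a::locally_convex_space set"
  assumes "zero_nhd V"
  obtains W where "zero_nhd W" "W \<subseteq> V" "absconvex W"
proof -
  obtain K where K: "open K" "0 \<in> K" "K \<subseteq> interior V" "convex K"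
    using assms open_interior ex_open_convex_nhd_0 unfolding zero_nhd_def by metis
  \<comment> \<open>The balanced core of K. As an intersection of preimages of K under linear maps
    it stays convex; joint continuity of scalar multiplication at (0, 0) makes it a zero
    neighborhood.\<close>
  let ?W = "{x. \<forall>c. cmod c \<le> 1 \<longrightarrow> c *\<^sub>C x \<in> K}"
  have "\<forall>\<^sub>F p in nhds 0 \<times>\<^sub>F nhds (0::'a). fst p *\<^sub>C snd p \<in> K"
    using tendsto_scaleC_Pair[of 0 "0::'a"] K by (auto simp: tendsto_def)
  then obtain P Q where PQ: "\<forall>\<^sub>F c in nhds 0. P c" "\<forall>\<^sub>F x in nhds (0::'a). Q x"
      "\<And>c x. P c \<Longrightarrow> Q x \<Longrightarrow> c *\<^sub>C x \<in> K"
    unfolding eventually_prod_filter by auto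
  obtain d where d: "d > 0" "\<And>c. cmod c < d \<Longrightarrow> P c"
    using PQ(1) unfolding eventually_nhds_metric by auto
  \<comment> \<open>Half of d, because P is known only for moduli strictly below d while |c| = 1 is
    allowed.\<close>
  have "zero_nhd ((\<lambda>x. (d / 2) *\<^sub>R x) ` {x. Q x})"
    using PQ(2) d(1) by (intro zero_nhd_image) (auto simp: zero_nhd_iff_eventually)
  moreover have "(\<lambda>x. (d / 2) *\<^sub>R x) ` {x. Q x} \<subseteq> ?W"
  proof clarify
    fix x c assume *: "Q x" "cmod c \<le> 1"
    have "cmod (c * complex_of_real (d / 2)) < d"
      using *(2) d(1) mult_right_mono[of "cmod c" 1 "d / 2"] by (simp add: norm_mult)
    with * d PQ(3) show "c *\<^sub>C (d / 2) *\<^sub>R x \<in> K"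
      by (metis scaleR_scaleC scaleC_scaleC)
  qed
  ultimately have "zero_nhd ?W"
    unfolding zero_nhd_def using interior_mono by blast
  moreover have "?W \<subseteq> V"
    using K(3) interior_subset[of V] by (auto dest!: spec[of _ 1] simp: scaleC_one)
  moreover have "convex ?W"
  proof (rule convexI)
    fix x y :: 'a and u v :: real
    assume "x \<in> ?W" "y \<in> ?W" "0 \<le> u" "0 \<le> v" "u + v = 1"
    then have "u *\<^sub>R c *\<^sub>C x + v *\<^sub>R c *\<^sub>C y \<in> K" if "cmod c \<le> 1" for c
      using that by (intro convexD[OF K(4)]) auto
    then show "u *\<^sub>R x + v *\<^sub>R y \<in> ?W"
      by (simp add: scaleC_add_right scaleC_scaleR_commute)
  qed
  then have "absconvex ?W"
    by (simp add: absconvex_def scaleC_scaleC norm_mult mult_le_one)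
  ultimately show thesis using that by blast
qed

text \<open>Additivity carries continuity at 0 to every point, and at 0 it can be tested on
  absolutely convex neighborhoods, since these form a base.\<close>

lemma linear_imp_continuous_on_lcs:
  fixes L :: "'a::locally_convex_space \<Rightarrow> 'a"
  assumes add: "\<And>x y. L (x + y) = L x + L y"
    and nhd: "\<And>W. zero_nhd W \<Longrightarrow> absconvex W \<Longrightarrow> \<exists>U. zero_nhd U \<and> L ` U \<subseteq> W"
  shows "continuous_on UNIV L"
proof -
  have zero: "(L \<longlongrightarrow> 0) (nhds 0)"
  proof (rule topological_tendstoI)
    fix S :: "'a set" assume "open S" "0 \<in> S"
    then have "zero_nhd S" by (simp add: zero_nhd_def interior_open)
    then obtain W where "zero_nhd W" "W \<subseteq> S" "absconvex W" by (rule ex_absconvex_zero_nhd)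
    with nhd obtain U where "zero_nhd U" "L ` U \<subseteq> S" by blast
    then show "\<forall>\<^sub>F x in nhds 0. L x \<in> S"
      unfolding zero_nhd_iff_eventually by (metis (mono_tags, lifting) eventually_mono image_subset_iff)
  qed
  have "(L \<longlongrightarrow> L a) (at a)" for a
  proof -
    have "((\<lambda>x. x - a) \<longlongrightarrow> 0) (at a)"
      using tendsto_diff[OF tendsto_ident_at tendsto_const, of a a UNIV] by simp
    then have "((\<lambda>x. L (x - a) + L a) \<longlongrightarrow> 0 + L a) (at a)"
      by (intro tendsto_add tendsto_const filterlim_compose[OF zero])
    then show ?thesis by (simp flip: add)
  qed
  then show ?thesis by (simp add: continuous_on)
qed

section \<open>Algebra of the Neumann partial sums for fixed \<mu> and \<nu>\<close>

context
  fixes T :: "'a::sequentially_complete_locally_convex_space \<Rightarrow> 'a" and \<mu> :: complex and \<nu> :: real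
  assumes lin: "Vector_Spaces.linear scaleC scaleC T"
    and cont: "continuous_on UNIV T"
    and \<nu>: "0 < \<nu>" "\<nu> < cmod \<mu>"
    and powers: "equicont_to_zero (\<lambda>n x. (T ^^ n) x /\<^sub>R \<nu> ^ n)"
begin

interpretation T: Vector_Spaces.linear "scaleC :: complex \<Rightarrow> 'a \<Rightarrow> 'a" scaleC T
  by (rule lin)

definition neumann_sum :: "nat \<Rightarrow> 'a \<Rightarrow> 'a" where
  "neumann_sum n x = (\<Sum>i<n. (1 / \<mu> ^ (i + 1)) *\<^sub>C (T ^^ i) x)"

text \<open>\<open>lim\<close> carries information only once convergence is known, which
  \<open>neumann_sum_tendsto\<close> supplies.\<close>

definition neumann_limit :: "'a \<Rightarrow> 'a" where
  "neumann_limit x = lim (\<lambda>n. neumann_sum n x)"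

lemma funpow_add: "(T ^^ n) (x + y) = (T ^^ n) x + (T ^^ n) y"
  by (induction n) (auto simp: T.add)

lemma funpow_scaleC: "(T ^^ n) (c *\<^sub>C x) = c *\<^sub>C (T ^^ n) x"
  by (induction n) (auto simp: T.scale)

lemma neumann_sum_add: "neumann_sum n (x + y) = neumann_sum n x + neumann_sum n y"
  by (simp add: neumann_sum_def funpow_add scaleC_add_right sum.distrib)

lemma neumann_sum_scaleC: "neumann_sum n (c *\<^sub>C x) = c *\<^sub>C neumann_sum n x"
  by (simp add: neumann_sum_def funpow_scaleC scaleC.scale_sum_right scaleC_scaleC mult.commute)

lemma neumann_sum_diff: "neumann_sum n (x - y) = neumann_sum n x - neumann_sum n y"
  using neumann_sum_add[of n "x - y" y] by (simp add: algebra_simps)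

lemma neumann_sum_commute: "neumann_sum n (T x) = T (neumann_sum n x)"
  by (simp add: neumann_sum_def T.sum T.scale funpow_swap1)

lemma mu_nz: "\<mu> \<noteq> 0"
  using \<nu> by auto

text \<open>T maps each summand to \<mu> times the next one, so all but the first and last
  contributions cancel.\<close>

lemma neumann_sum_telescope:
  "\<mu> *\<^sub>C neumann_sum n x - T (neumann_sum n x) = x - (1 / \<mu> ^ n) *\<^sub>C (T ^^ n) x"
proof (induction n)
  case 0
  then show ?case by (simp add: neumann_sum_def scaleC_one)
next
  case (Suc n)
  have "neumann_sum (Suc n) x = neumann_sum n x + (1 / \<mu> ^ (n + 1)) *\<^sub>C (T ^^ n) x"
    by (simp add: neumann_sum_def)
  then have "\<mu> *\<^sub>C neumann_sum (Suc n) x - T (neumann_sum (Suc n) x) =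
      (\<mu> *\<^sub>C neumann_sum n x - T (neumann_sum n x)) +
      (\<mu> *\<^sub>C (1 / \<mu> ^ (n + 1)) *\<^sub>C (T ^^ n) x - (1 / \<mu> ^ (n + 1)) *\<^sub>C (T ^^ Suc n) x)"
    by (simp add: T.add T.scale scaleC_add_right)
  also have "\<mu> *\<^sub>C (1 / \<mu> ^ (n + 1)) *\<^sub>C (T ^^ n) x = (1 / \<mu> ^ n) *\<^sub>C (T ^^ n) x"
    using mu_nz by (simp add: scaleC_scaleC)
  finally show ?case using Suc.IH by simp
qed

section \<open>Continuity and uniform convergence of the partial sums\<close>

lemma continuous_neumann_sum: "continuous_on UNIV (neumann_sum n)"
proof -
  have "continuous_on UNIV (T ^^ i)" for i
    by (induction i) (auto intro: continuous_on_compose2[OF cont] simp: id_def)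
  then show ?thesis
    unfolding neumann_sum_def continuous_on_def by (intro ballI tendsto_sum tendsto_scaleC) auto
qed

text \<open>U is fixed before \<epsilon>, the order of quantifiers that equicontinuous convergence
  demands.\<close>

lemma neumann_sum_uniform_Cauchy:
  assumes "zero_nhd W" "absconvex W"
  obtains U where "zero_nhd U"
    "\<And>\<epsilon>. \<epsilon> > 0 \<Longrightarrow> \<exists>N. \<forall>m\<ge>N. \<forall>n\<ge>N. \<forall>x\<in>U.
      neumann_sum m x - neumann_sum n x \<in> (\<lambda>x. \<epsilon> *\<^sub>R x) ` W"
proof -
  obtain U where U: "zero_nhd U"
    "\<forall>\<epsilon>>0. \<exists>n0. \<forall>n>n0. (\<lambda>x. (T ^^ n) x /\<^sub>R \<nu> ^ n) ` U \<subseteq> (\<lambda>x. \<epsilon> *\<^sub>R x) ` W"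
    using powers assms(1) unfolding equicont_to_zero_def by blast
  \<comment> \<open>The value 1 for \<epsilon> suffices here: smallness will come from the tails of
    \<open>a\<close>.\<close>
  then obtain n0 where n0:
    "\<forall>n>n0. (\<lambda>x. (T ^^ n) x /\<^sub>R \<nu> ^ n) ` U \<subseteq> (\<lambda>x. 1 *\<^sub>R x) ` W"
    using zero_less_one by blast
  have inW: "(T ^^ n) x /\<^sub>R \<nu> ^ n \<in> W" if "n > n0" "x \<in> U" for n x
    using n0 that by auto
  \<comment> \<open>The modulus of the coefficient left when T^i x is written as \<nu>^i times an
    element of W; geometric with ratio \<nu> / |\<mu>| < 1.\<close>
  define a where "a i = \<nu> ^ i / cmod \<mu> ^ (i + 1)" for i
  have "summable (\<lambda>i. inverse (cmod \<mu>) * (\<nu> / cmod \<mu>) ^ i)"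
    using \<nu> by (intro summable_mult summable_geometric) (auto simp: divide_less_eq)
  then have summ: "summable a"
    by (simp add: a_def[abs_def] power_divide divide_inverse power_mult_distrib
        power_inverse mult_ac del: summable_cmult_iff)
  have "\<exists>N. \<forall>m\<ge>N. \<forall>n\<ge>N. \<forall>x\<in>U.
      neumann_sum m x - neumann_sum n x \<in> (\<lambda>x. \<epsilon> *\<^sub>R x) ` W" if "\<epsilon> > 0" for \<epsilon>
  proof -
    obtain N where N: "\<And>m n. m \<ge> N \<Longrightarrow> norm (sum a {m..<n}) < \<epsilon>"
      using summ \<open>\<epsilon> > 0\<close> unfolding summable_Cauchy by blast
    \<comment> \<open>N makes the segment of \<open>a\<close> small; \<open>Suc n0\<close> is there
      because the bound on the powers holds only strictly beyond n0.\<close>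
    have step: "neumann_sum n x - neumann_sum m x \<in> (\<lambda>x. \<epsilon> *\<^sub>R x) ` W"
      if mn: "m \<ge> max N (Suc n0)" "n \<ge> m" and x: "x \<in> U" for m n x
    proof -
      let ?c = "\<lambda>i. complex_of_real (\<nu> ^ i) / \<mu> ^ (i + 1)"
      have "neumann_sum n x - neumann_sum m x =
          (\<Sum>i=m..<n. (1 / \<mu> ^ (i + 1)) *\<^sub>C (T ^^ i) x)"
        unfolding neumann_sum_def using sum_diff_nat_ivl[of 0 m n] mn
        by (simp add: lessThan_atLeast0)
      also have "\<dots> = (\<Sum>i=m..<n. ?c i *\<^sub>C ((T ^^ i) x /\<^sub>R \<nu> ^ i))"
        using \<nu> by (intro sum.cong) (auto simp: scaleR_scaleC scaleC_scaleC)
      also have "\<dots> \<in> (\<lambda>x. (\<Sum>i=m..<n. cmod (?c i)) *\<^sub>R x) ` W"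
        using assms inW x mn by (intro absconvex_sum) (auto simp: zero_nhd_def)
      also have "(\<Sum>i=m..<n. cmod (?c i)) = sum a {m..<n}"
        using \<nu> by (intro sum.cong) (auto simp: a_def norm_divide norm_mult norm_power)
      also have "(\<lambda>x. sum a {m..<n} *\<^sub>R x) ` W \<subseteq> (\<lambda>x. \<epsilon> *\<^sub>R x) ` W"
        using N[of m n] mn \<open>\<epsilon> > 0\<close> by (intro absconvex_image_mono assms) auto
      finally show ?thesis .
    qed
    have "neumann_sum m x - neumann_sum n x \<in> (\<lambda>x. \<epsilon> *\<^sub>R x) ` W"
      if "m \<ge> max N (Suc n0)" "n \<ge> max N (Suc n0)" "x \<in> U" for m n x
    \<comment> \<open>The order of m and n does not matter because W = -W.\<close>
    proof (cases "n \<le> m")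
      case True
      then show ?thesis using step that by blast
    next
      case False
      then have "- (neumann_sum n x - neumann_sum m x) \<in> (\<lambda>x. \<epsilon> *\<^sub>R x) ` W"
        using step that by (intro absconvex_uminus_image assms) auto
      then show ?thesis by simp
    qed
    then show ?thesis by blast
  qed
  with U(1) show thesis using that by blast
qed

text \<open>An arbitrary x is scaled into U by some t > 0. The uniform Cauchy property with
  \<epsilon> = t puts t times a difference of partial sums into t W, and t cancels.\<close>

lemma neumann_sum_tendsto: "(\<lambda>n. neumann_sum n x) \<longlonglongrightarrow> neumann_limit x"
proof -
  have "convergent (\<lambda>n. neumann_sum n x)"
  proof (rule sequentially_complete)
    fix V :: "'a set" assume "open V" "0 \<in> V"
    then have "zero_nhd V" by (simp add: zero_nhd_def interior_open)
    then obtain W where W: "zero_nhd W" "W \<subseteq> V" "absconvex W" by (rule ex_absconvex_zero_nhd)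
    obtain U where U: "zero_nhd U"
      "\<And>\<epsilon>. \<epsilon> > 0 \<Longrightarrow> \<exists>N. \<forall>m\<ge>N. \<forall>n\<ge>N. \<forall>x\<in>U.
        neumann_sum m x - neumann_sum n x \<in> (\<lambda>x. \<epsilon> *\<^sub>R x) ` W"
      using neumann_sum_uniform_Cauchy[OF W(1,3)] by blast
    obtain t where t: "t > 0" "t *\<^sub>R x \<in> U" using zero_nhd_absorbing[OF U(1)] by blast
    obtain N where N: "\<forall>m\<ge>N. \<forall>n\<ge>N. \<forall>x\<in>U.
        neumann_sum m x - neumann_sum n x \<in> (\<lambda>x. t *\<^sub>R x) ` W"
      using U(2) t(1) by blast
    have "neumann_sum m x - neumann_sum n x \<in> V" if "m \<ge> N" "n \<ge> N" for m n
    proof -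
      have "neumann_sum m (t *\<^sub>R x) - neumann_sum n (t *\<^sub>R x) \<in> (\<lambda>x. t *\<^sub>R x) ` W"
        using N that t by blast
      then have "t *\<^sub>R (neumann_sum m x - neumann_sum n x) \<in> (\<lambda>x. t *\<^sub>R x) ` W"
        by (simp add: scaleR_scaleC neumann_sum_scaleC scaleC.scale_right_diff_distrib)
      then show ?thesis using t(1) W(2) by auto
    qed
    then show "\<exists>N. \<forall>m\<ge>N. \<forall>n\<ge>N. neumann_sum m x - neumann_sum n x \<in> V" by blast
  qed
  then show ?thesis by (simp add: neumann_limit_def convergent_LIMSEQ_iff)
qed

text \<open>Lets m tend to infinity in the Cauchy property. W need not be closed, so half of
  \<epsilon> is reserved for the distance from the m-th partial sum to the limit.\<close>

lemma neumann_sum_uniform_limit: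
  assumes W: "zero_nhd W" "absconvex W"
  obtains U where "zero_nhd U"
    "\<And>\<epsilon>. \<epsilon> > 0 \<Longrightarrow> \<exists>N. \<forall>n\<ge>N. \<forall>x\<in>U. neumann_sum n x - neumann_limit x \<in> (\<lambda>x. \<epsilon> *\<^sub>R x) ` W"
proof -
  obtain U where U: "zero_nhd U"
    "\<And>\<epsilon>. \<epsilon> > 0 \<Longrightarrow> \<exists>N. \<forall>m\<ge>N. \<forall>n\<ge>N. \<forall>x\<in>U.
      neumann_sum m x - neumann_sum n x \<in> (\<lambda>x. \<epsilon> *\<^sub>R x) ` W"
    using neumann_sum_uniform_Cauchy[OF W] by blast
  have "\<exists>N. \<forall>n\<ge>N. \<forall>x\<in>U. neumann_sum n x - neumann_limit x \<in> (\<lambda>x. \<epsilon> *\<^sub>R x) ` W"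
    if "\<epsilon> > 0" for \<epsilon>
  proof -
    obtain N where N: "\<forall>m\<ge>N. \<forall>n\<ge>N. \<forall>x\<in>U.
        neumann_sum m x - neumann_sum n x \<in> (\<lambda>x. (\<epsilon> / 2) *\<^sub>R x) ` W"
      using U(2) half_gt_zero[OF \<open>\<epsilon> > 0\<close>] by blast
    have "neumann_sum n x - neumann_limit x \<in> (\<lambda>x. \<epsilon> *\<^sub>R x) ` W" if "n \<ge> N" "x \<in> U" for n x
    proof -
      have "(\<lambda>m. neumann_sum m x - neumann_limit x) \<longlonglongrightarrow> 0"
        using tendsto_diff[OF neumann_sum_tendsto tendsto_const, of x "neumann_limit x"] by simp
      moreover have "zero_nhd ((\<lambda>x. (\<epsilon> / 2) *\<^sub>R x) ` W)"
        using W \<open>\<epsilon> > 0\<close> by (intro zero_nhd_image) auto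
      ultimately have
        "\<forall>\<^sub>F m in sequentially. neumann_sum m x - neumann_limit x \<in> (\<lambda>x. (\<epsilon> / 2) *\<^sub>R x) ` W"
        using zero_nhd_tendsto by blast
      \<comment> \<open>This m depends on x, but it drops out of the conclusion, so N stays uniform
        on U.\<close>
      then obtain m where m: "m \<ge> N"
        "neumann_sum m x - neumann_limit x \<in> (\<lambda>x. (\<epsilon> / 2) *\<^sub>R x) ` W"
        unfolding eventually_sequentially by (meson max.cobounded1 max.cobounded2)
      have "(neumann_sum n x - neumann_sum m x) + (neumann_sum m x - neumann_limit x)
          \<in> (\<lambda>x. (\<epsilon> / 2 + \<epsilon> / 2) *\<^sub>R x) ` W"
        using N m that \<open>\<epsilon> > 0\<close> W(2) by (intro convex_image_add) (auto simp: absconvex_def)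
      then show ?thesis by simp
    qed
    then show ?thesis by blast
  qed
  with U(1) show thesis using that by blast
qed

section \<open>The limit as a continuous two-sided inverse\<close>

lemma neumann_limit_add: "neumann_limit (x + y) = neumann_limit x + neumann_limit y"
  using tendsto_add[OF neumann_sum_tendsto[of x] neumann_sum_tendsto[of y]]
    neumann_sum_tendsto[of "x + y"]
  by (simp add: neumann_sum_add LIMSEQ_unique)

lemma continuous_neumann_limit: "continuous_on UNIV neumann_limit"
proof (rule linear_imp_continuous_on_lcs)
  fix W :: "'a set" assume W: "zero_nhd W" "absconvex W"
  obtain U where U: "zero_nhd U"
    "\<And>\<epsilon>. \<epsilon> > 0 \<Longrightarrow> \<exists>N. \<forall>n\<ge>N. \<forall>x\<in>U. neumann_sum n x - neumann_limit x \<in> (\<lambda>x. \<epsilon> *\<^sub>R x) ` W"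
    using neumann_sum_uniform_limit[OF W] by blast
  \<comment> \<open>One half of W is for the error of the N-th partial sum, the other for that
    partial sum itself.\<close>
  obtain N where N:
    "\<forall>n\<ge>N. \<forall>x\<in>U. neumann_sum n x - neumann_limit x \<in> (\<lambda>x. (1 / 2) *\<^sub>R x) ` W"
    using U(2)[of "1 / 2"] by auto
  let ?H = "(\<lambda>x. (1 / 2) *\<^sub>R x) ` W"
  have "(neumann_sum N \<longlongrightarrow> neumann_sum N 0) (nhds 0)"
    using continuous_neumann_sum by (auto simp: continuous_on_def tendsto_at_iff_tendsto_nhds)
  moreover have "neumann_sum N 0 = 0" using neumann_sum_add[of N 0 0] by simp
  ultimately have "\<forall>\<^sub>F x in nhds 0. neumann_sum N x \<in> ?H"
    using zero_nhd_tendsto[OF zero_nhd_image[OF W(1), of "1 / 2"]] by simp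
  \<comment> \<open>U is shrunk by the preimage of \<open>?H\<close> under the continuous N-th
    partial sum.\<close>
  then have "zero_nhd {x \<in> U. neumann_sum N x \<in> ?H}"
    using U(1) by (simp add: zero_nhd_iff_eventually eventually_conj_iff)
  moreover have "neumann_limit x \<in> W" if "x \<in> U" "neumann_sum N x \<in> ?H" for x
  proof -
    have "- (neumann_sum N x - neumann_limit x) \<in> ?H"
      using N that W by (intro absconvex_uminus_image) auto
    then have "neumann_sum N x + - (neumann_sum N x - neumann_limit x)
        \<in> (\<lambda>x. (1 / 2 + 1 / 2) *\<^sub>R x) ` W"
      using that W by (intro convex_image_add) (auto simp: absconvex_def)
    then show ?thesis by simp
  qed
  ultimately show "\<exists>U. zero_nhd U \<and> neumann_limit ` U \<subseteq> W" by blast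
qed (rule neumann_limit_add)

text \<open>Both sides are limits of the same sequence: one by continuity of T, the other by
  \<open>neumann_sum_telescope\<close> with vanishing remainder.\<close>

lemma neumann_limit_right_inverse: "\<mu> *\<^sub>C neumann_limit x - T (neumann_limit x) = x"
proof (rule LIMSEQ_unique)
  let ?S = "\<lambda>n. neumann_sum n x"
  have "(T \<longlongrightarrow> T (neumann_limit x)) (nhds (neumann_limit x))"
    using cont by (auto simp: continuous_on_def tendsto_at_iff_tendsto_nhds)
  then have "(\<lambda>n. T (?S n)) \<longlonglongrightarrow> T (neumann_limit x)"
    using neumann_sum_tendsto by (rule filterlim_compose)
  then show "(\<lambda>n. \<mu> *\<^sub>C ?S n - T (?S n)) \<longlonglongrightarrow> \<mu> *\<^sub>C neumann_limit x - T (neumann_limit x)"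
    by (intro tendsto_diff tendsto_scaleC tendsto_const neumann_sum_tendsto)
  \<comment> \<open>The remainder is \<mu> times the n-th term of a convergent series, hence tends
    to 0.\<close>
  have "(\<lambda>n. \<mu> *\<^sub>C (?S (Suc n) - ?S n)) \<longlonglongrightarrow> \<mu> *\<^sub>C (neumann_limit x - neumann_limit x)"
    by (intro tendsto_diff tendsto_scaleC tendsto_const neumann_sum_tendsto
        LIMSEQ_Suc[OF neumann_sum_tendsto])
  moreover have "\<mu> *\<^sub>C (?S (Suc n) - ?S n) = (1 / \<mu> ^ n) *\<^sub>C (T ^^ n) x" for n
    using mu_nz by (simp add: neumann_sum_def scaleC_scaleC)
  ultimately have "(\<lambda>n. (1 / \<mu> ^ n) *\<^sub>C (T ^^ n) x) \<longlonglongrightarrow> 0" by simp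
  from tendsto_diff[OF tendsto_const this, of x]
  show "(\<lambda>n. \<mu> *\<^sub>C ?S n - T (?S n)) \<longlonglongrightarrow> x"
    by (simp add: neumann_sum_telescope)
qed

text \<open>T commutes with the partial sums and, being continuous, with their limit; this reduces
  the claim to the right inverse.\<close>

lemma neumann_limit_left_inverse: "neumann_limit (\<mu> *\<^sub>C x - T x) = x"
proof -
  have "(\<lambda>n. neumann_sum n (T x)) \<longlonglongrightarrow> T (neumann_limit x)"
    unfolding neumann_sum_commute
    using cont neumann_sum_tendsto by (intro continuous_on_tendsto_compose[OF cont]) auto
  then have "(\<lambda>n. neumann_sum n (\<mu> *\<^sub>C x - T x)) \<longlonglongrightarrow>
      \<mu> *\<^sub>C neumann_limit x - T (neumann_limit x)"
    unfolding neumann_sum_diff neumann_sum_scaleC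
    by (intro tendsto_diff tendsto_scaleC tendsto_const neumann_sum_tendsto)
  then show ?thesis
    using neumann_sum_tendsto[of "\<mu> *\<^sub>C x - T x"] LIMSEQ_unique
    by (fastforce simp: neumann_limit_right_inverse)
qed

lemma bij_resolvent: "bij (\<lambda>x. \<mu> *\<^sub>C x - T x)"
  using neumann_limit_left_inverse neumann_limit_right_inverse
  by (intro o_bij[of neumann_limit]) auto

lemma resolvent_eq_neumann_limit: "resolvent T \<mu> = neumann_limit"
  unfolding resolvent_def using neumann_limit_left_inverse neumann_limit_right_inverse
  by (intro inv_equality) auto

text \<open>V need not be absolutely convex; the U found for an absolutely convex W inside V works,
  as \<epsilon> W lies in \<epsilon> V.\<close>

lemma equicont_sums_neumann:
  "equicont_sums (\<lambda>i x. (1 / \<mu> ^ (i + 1)) *\<^sub>C (T ^^ i) x) neumann_limit"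
  unfolding equicont_sums_def equicont_converges_def equicont_to_zero_def
    neumann_sum_def[symmetric]
proof (intro allI impI)
  fix V :: "'a set" assume "zero_nhd V"
  then obtain W where W: "zero_nhd W" "W \<subseteq> V" "absconvex W" by (rule ex_absconvex_zero_nhd)
  obtain U where U: "zero_nhd U"
    "\<And>\<epsilon>. \<epsilon> > 0 \<Longrightarrow> \<exists>N. \<forall>n\<ge>N. \<forall>x\<in>U. neumann_sum n x - neumann_limit x \<in> (\<lambda>x. \<epsilon> *\<^sub>R x) ` W"
    using neumann_sum_uniform_limit[OF W(1,3)] by blast
  have "\<exists>n0. \<forall>n>n0. (\<lambda>x. neumann_sum n x - neumann_limit x) ` U \<subseteq> (\<lambda>x. \<epsilon> *\<^sub>R x) ` V"
    if "\<epsilon> > 0" for \<epsilon>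
  proof -
    obtain N where
      "\<forall>n\<ge>N. \<forall>x\<in>U. neumann_sum n x - neumann_limit x \<in> (\<lambda>x. \<epsilon> *\<^sub>R x) ` W"
      using U(2)[OF \<open>\<epsilon> > 0\<close>] by blast
    then have "neumann_sum n x - neumann_limit x \<in> (\<lambda>x. \<epsilon> *\<^sub>R x) ` V" if "n > N" "x \<in> U" for n x
      using that by (intro subsetD[OF image_mono[OF W(2)]]) simp
    then show ?thesis by (intro exI[of _ N] allI impI image_subsetI)
  qed
  with U(1) show "\<exists>U. zero_nhd U \<and> (\<forall>\<epsilon>>0. \<exists>n0. \<forall>n>n0.
      (\<lambda>x. neumann_sum n x - neumann_limit x) ` U \<subseteq> (\<lambda>x. \<epsilon> *\<^sub>R x) ` V)"
    by blast
qed

end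

section \<open>Resolvent beyond the spectral radius and the bound on the spectrum\<close>

theorem theorem5p3:
  fixes T :: "'a::sequentially_complete_locally_convex_space \<Rightarrow> 'a"
  assumes "Vector_Spaces.linear scaleC scaleC T"
    and "continuous_on UNIV T"
  shows "(\<forall>\<mu>::complex. ennreal (cmod \<mu>) > spectral_radius T \<longrightarrow>
            bij (\<lambda>x. \<mu> *\<^sub>C x - T x) \<and>
            equicont_sums (\<lambda>i x. (1 / \<mu> ^ (i + 1)) *\<^sub>C (T ^^ i) x) (resolvent T \<mu>) \<and>
            continuous_on UNIV (resolvent T \<mu>)) \<and>
         set_radius (spectrum T) \<le> spectral_radius T"
proof -
  have main: "bij (\<lambda>x. \<mu> *\<^sub>C x - T x) \<and>
      equicont_sums (\<lambda>i x. (1 / \<mu> ^ (i + 1)) *\<^sub>C (T ^^ i) x) (resolvent T \<mu>) \<and>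
      continuous_on UNIV (resolvent T \<mu>)"
    if "ennreal (cmod \<mu>) > spectral_radius T" for \<mu>
  proof -
    \<comment> \<open>An infimum strictly below |\<mu>| has a member of its set strictly below
      |\<mu>|.\<close>
    obtain \<nu> where \<nu>: "\<nu> > 0" "\<nu> < cmod \<mu>"
      and powers: "equicont_to_zero (\<lambda>n x. (T ^^ n) x /\<^sub>R \<nu> ^ n)"
      using \<open>ennreal (cmod \<mu>) > spectral_radius T\<close>
      unfolding spectral_radius_def Inf_less_iff by (auto simp: ennreal_less_iff)
    note params = assms \<nu> powers
    show ?thesis
      using bij_resolvent[OF params] equicont_sums_neumann[OF params]
        continuous_neumann_limit[OF params]
      by (simp add: resolvent_eq_neumann_limit[OF params])
  qed
  moreover have "set_radius (spectrum T) \<le> spectral_radius T"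
    unfolding set_radius_def
  proof (rule SUP_least)
    fix \<mu> assume "\<mu> \<in> spectrum T"
    \<comment> \<open>By contraposition: beyond the spectral radius, \<open>main\<close> puts \<mu>
      into the resolvent set.\<close>
    then show "ennreal (cmod \<mu>) \<le> spectral_radius T"
      using main[of \<mu>] by (auto simp: spectrum_def resolvent_set_def not_less[symmetric])
  qed
  ultimately show ?thesis by blast
qed

end
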